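(* Let $p$ be an odd prime and $a\in\mathbb{Z}_p$. Then $$P_{p-1}(a,-1)=\sum_{k=0}^{p-1}\binom ak\binom{-1-a}k\equiv (-1)^{\langle a\rangle_p}\pmod{p^2}.$$
   Context: $\mathbb{Z}_p$ denotes the set of rational $p$-integers, i.e. rational numbers whose denominator is not divisible by $p$; congruences are in $\mathbb{Z}_p$. For $a\in\mathbb{Z}_p$, $\langle a\rangle_p\in\{0,1,\ldots,p-1\}$ is the least nonnegative residue of $a$ modulo $p$. $\binom ak=a(a-1)\cdots(a-k+1)/k!$ (with $\binom a0=1$). The generalized Legendre polynomial is $P_n(a,x)=\sum_{k=0}^n\binom ak\binom{-1-a}k\left(\frac{1-x}2\right)^k$. *)

theory Defs
  imports Complex_Main "HOL-Number_Theory.Cong"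
begin

text \<open>
  The rational \<open>p\<close>-integers, as a subset of the type \<^typ>\<open>rat\<close>. The second component of
  \<^const>\<open>quotient_of\<close> is the positive denominator of the fraction in lowest terms.
\<close>
definition p_integers :: "nat \<Rightarrow> rat set" where
  "p_integers p = {x. \<not> int p dvd snd (quotient_of x)}"

text \<open>
  \<open>x \<equiv> y (mod m)\<close> in the ring of \<open>p\<close>-integers: the quotient is required to be a
  \<open>p\<close>-integer. The library's \<^const>\<open>cong\<close> cannot be used here, since in the field of rational
  numbers divisibility is trivial.
\<close>
definition p_cong :: "nat \<Rightarrow> nat \<Rightarrow> rat \<Rightarrow> rat \<Rightarrow> bool" where
  "p_cong p m x y \<longleftrightarrow>
     x \<in> p_integers p \<and> y \<in> p_integers p \<and> (\<exists>z \<in> p_integers p. x - y = of_nat m * z)"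

text \<open>Meaningful for prime \<open>p\<close> and \<open>a \<in> p_integers p\<close> only; see the lemmas below.\<close>
definition least_residue :: "nat \<Rightarrow> rat \<Rightarrow> nat" where
  "least_residue p a = (LEAST r. p_cong p p a (of_nat r))"

definition gen_legendre :: "nat \<Rightarrow> rat \<Rightarrow> rat \<Rightarrow> rat" where
  "gen_legendre n a x = (\<Sum>k=0..n. (a gchoose k) * ((- 1 - a) gchoose k) * ((1 - x) / 2) ^ k)"

lemma ex_residue:
  assumes "prime p" and "a \<in> p_integers p"
  shows "\<exists>r<p. p_cong p p a (of_nat r)"
proof -
  obtain u v where q: "quotient_of a = (u, v)" by force
  have v0: "v > 0" and cop: "coprime u v" and a: "a = of_int u / of_int v"
    using q quotient_of_denom_pos quotient_of_coprime quotient_of_div by auto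
  have nd: "\<not> int p dvd v" using assms(2) q by (simp add: p_integers_def)
  have p0: "int p > 0" using assms(1) prime_gt_0_nat by simp
  have "coprime v (int p)"
    using nd assms(1) by (metis coprime_commute prime_imp_coprime prime_nat_int_transfer)
  then obtain w where w: "[v * w = 1] (mod int p)"
    using cong_solve_coprime_int by blast
  define r where "r = nat ((u * w) mod int p)"
  have ri: "int r = (u * w) mod int p" using p0 by (simp add: r_def)
  have "r < p" using p0 ri by (metis of_nat_less_iff pos_mod_bound)
  have "[v * int r = v * (u * w)] (mod int p)"
    unfolding ri by (simp add: cong_def mod_simps)
  also have "v * (u * w) = u * (v * w)" by (simp add: algebra_simps)
  also have "[u * (v * w) = u * 1] (mod int p)" using w by (rule cong_scalar_left)
  finally have "int p dvd u - v * int r"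
    by (simp add: cong_iff_dvd_diff dvd_diff_commute)
  then obtain t where t: "u - v * int r = int p * t" by (elim dvdE)
  have "(of_int (u - v * int r) :: rat) = of_int (int p * t)" using t by simp
  then have eq: "a - of_nat r = of_nat p * (of_int t / of_int v)"
    using v0 by (simp add: a field_simps)
  have "snd (quotient_of (of_int t / of_int v)) dvd v"
  proof -
    obtain t' v' where q': "quotient_of (of_int t / of_int v :: rat) = (t', v')" by force
    have v0': "v' > 0" and cop': "coprime t' v'"
      and e: "(of_int t / of_int v :: rat) = of_int t' / of_int v'"
      using q' quotient_of_denom_pos quotient_of_coprime quotient_of_div by auto
    have "(of_int (t * v') :: rat) = of_int (t' * v)"
      using e v0 v0' by (simp add: field_simps)
    then have "t * v' = t' * v" by (simp only: of_int_eq_iff)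
    then have "v' dvd t' * v" by (metis dvd_triv_right)
    then have "v' dvd v" using cop' by (simp add: coprime_commute coprime_dvd_mult_right_iff)
    then show ?thesis using q' by simp
  qed
  then have "(of_int t / of_int v :: rat) \<in> p_integers p"
    using nd by (auto simp: p_integers_def intro: dvd_trans)
  moreover have "(of_nat r :: rat) \<in> p_integers p"
    using assms(1) not_prime_1 by (auto simp: p_integers_def)
  ultimately show ?thesis
    using \<open>r < p\<close> eq assms(2) unfolding p_cong_def by blast
qed

lemma least_residue_cong:
  assumes "prime p" and "a \<in> p_integers p"
  shows "p_cong p p a (of_nat (least_residue p a))"
  unfolding least_residue_def using ex_residue[OF assms] by (metis (mono_tags, lifting) LeastI)

lemma least_residue_less:
  assumes "prime p" and "a \<in> p_integers p"
  shows "least_residue p a < p"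
  unfolding least_residue_def using ex_residue[OF assms] by (meson Least_le le_less_trans)

end

theory Submission
  imports Defs
begin

text \<open>
  For \<open>k < p\<close> the binomial coefficient \<open>x gchoose k\<close> is a polynomial in \<open>x\<close> whose only
  denominator, \<open>fact k\<close>, is prime to \<open>p\<close>. So the sum modulo \<open>p\<^sup>2\<close> depends only on \<open>a\<close> modulo
  \<open>p\<^sup>2\<close> (lemma \<open>p_cong_gbinomial\<close>), and \<open>a\<close> may be replaced by a natural number \<open>n\<close> in the same
  class (lemma \<open>ex_nat_p_cong_square\<close>). This turns a statement about a \<open>p\<close>-adic variable into one
  that can be proved by induction.

  For natural \<open>n\<close> the sum is \<open>S(n) = (\<Sum>k\<le>p-1. (-1)^k * (n choose k) * (n + k choose k))\<close>, and two
  consecutive values add up to a single product (lemma \<open>alt_binomial_sum_Suc\<close>):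
  \<open>S(n) + S(n-1) = 2 * (n - 1 choose (p - 1)) * (n + p - 1 choose (p - 1))\<close>, the sign \<open>(-1)^(p-1)\<close>
  being \<open>1\<close> as \<open>p\<close> is odd. Up to the unit \<open>(fact (p - 1))\<^sup>2\<close>, the product of the two binomial
  coefficients is \<open>(\<Prod>i=1..p-1. n\<^sup>2 - i\<^sup>2)\<close>. Modulo \<open>p\<^sup>2\<close> it therefore vanishes if \<open>p\<close> does not
  divide \<open>n\<close>, each of the two factors being divisible by \<open>p\<close>, and it is \<open>1\<close> if \<open>p\<close> divides \<open>n\<close>.
  So, modulo \<open>p\<^sup>2\<close>, \<open>S\<close> starts with \<open>S(0) = 1\<close> and changes sign at each step except the step to a multiple of
  \<open>p\<close>, where \<open>S(n) = 2 - S(n-1)\<close>. Within a block of \<open>p\<close> consecutive arguments that starts at a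
  multiple of \<open>p\<close> there are \<open>p - 1\<close> sign changes, an even number, so the last value is \<open>1\<close> again
  and the next block also starts with \<open>1\<close>. This is \<open>S(n) = (-1)^(n mod p)\<close>.
\<close>

section \<open>The alternating binomial sum at natural numbers\<close>

definition alt_binomial_sum :: "nat \<Rightarrow> nat \<Rightarrow> int" where
  "alt_binomial_sum N n = (\<Sum>k\<le>N. (- 1) ^ k * int (n choose k) * int ((n + k) choose k))"

text \<open>
  The \<open>k\<close>-th terms of the two sums on the left add up to a difference of consecutive values of the
  right-hand side, so the sum telescopes. By Pascal's rule that difference identity reduces to
  equality, in cross-multiplied form, of the two ratios \<open>(n + 1 choose K + 1) / (n choose K)\<close> and
  \<open>(n + 1 + K choose K + 1) / (n + 1 + K choose K)\<close>, which are both \<open>(n + 1) / (K + 1)\<close>.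
\<close>
lemma alt_binomial_sum_Suc:
  "alt_binomial_sum N (Suc n) + alt_binomial_sum N n =
     2 * (- 1) ^ N * int (n choose N) * int ((Suc n + N) choose N)"
proof (induction N)
  case 0
  show ?case by (simp add: alt_binomial_sum_def)
next
  case (Suc K)
  define x y where "x = int (n choose K)" and "y = int (n choose Suc K)"
  define u v where "u = int ((Suc n + K) choose K)" and "v = int ((Suc n + K) choose Suc K)"
  have "Suc K * (Suc n choose Suc K) = Suc n * (n choose K)"
    using Suc_times_binomial_eq[of n K] by (simp only: mult.commute)
  then have "int (Suc K * (Suc n choose Suc K)) = int (Suc n * (n choose K))" by presburger
  then have xy: "int (Suc K) * (x + y) = int (Suc n) * x"
    unfolding x_def y_def of_nat_mult binomial_Suc_Suc of_nat_add .
  have "Suc K * ((Suc n + K) choose Suc K) = Suc n * ((Suc n + K) choose K)"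
    using binomial_absorb_comp[of "Suc n + K" K] Suc_times_binomial[of K "n + K"]
    by (simp del: binomial_Suc_Suc mult_Suc)
  then have "int (Suc K * ((Suc n + K) choose Suc K)) = int (Suc n * ((Suc n + K) choose K))"
    by presburger
  then have uv: "int (Suc K) * v = int (Suc n) * u"
    unfolding u_def v_def of_nat_mult .
  have "int (Suc K) * (x * v) = x * (int (Suc n) * u)" using uv by (simp only: mult.left_commute)
  also have "\<dots> = (int (Suc n) * x) * u" by (simp only: ac_simps)
  also have "\<dots> = int (Suc K) * ((x + y) * u)" by (simp only: xy[symmetric] mult.assoc)
  finally have ratio: "x * v = (x + y) * u" by simp
  have step: "alt_binomial_sum (Suc K) m = alt_binomial_sum K m -
      (- 1) ^ K * (int (m choose Suc K) * int ((m + Suc K) choose Suc K))" for m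
    by (simp add: alt_binomial_sum_def del: binomial_Suc_Suc)
  have sucs: "int (Suc n choose Suc K) = x + y" "int ((Suc n + Suc K) choose Suc K) = u + v"
    "int ((n + Suc K) choose Suc K) = v"
    by (simp_all add: x_def y_def u_def v_def)
  have "alt_binomial_sum (Suc K) (Suc n) + alt_binomial_sum (Suc K) n =
      (alt_binomial_sum K (Suc n) + alt_binomial_sum K n)
      - (- 1) ^ K * ((x + y) * (u + v) + y * v)"
    unfolding step sucs y_def[symmetric] by (simp only: algebra_simps)
  also have "alt_binomial_sum K (Suc n) + alt_binomial_sum K n = 2 * (- 1) ^ K * x * u"
    unfolding Suc.IH x_def u_def ..
  also have "(x + y) * (u + v) + y * v = 2 * x * u + 2 * y * (u + v)"
    using ratio by (simp add: algebra_simps)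
  finally show ?case
    unfolding sucs y_def[symmetric] by (simp add: algebra_simps)
qed

section \<open>The product of binomial coefficients modulo the square of a prime\<close>

lemma prime_dvd_binomial_pred:
  assumes "prime p" and "\<not> p dvd Suc n"
  shows "p dvd (n choose (p - 1))"
proof -
  have "Suc n * (n choose (p - 1)) = (Suc n choose p) * p"
    using Suc_times_binomial_eq[of n "p - 1"] prime_gt_0_nat[OF assms(1)] by simp
  then have "p dvd Suc n * (n choose (p - 1))" by (metis dvd_triv_right)
  then show ?thesis using assms prime_dvd_multD by blast
qed

lemma fact_square_binomial_product:
  "(fact N)\<^sup>2 * int (n choose N) * int ((Suc n + N) choose N) =
     (\<Prod>i=1..N. (int (Suc n))\<^sup>2 - (int i)\<^sup>2)"
proof (induction N)
  case 0
  show ?case by simp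
next
  case (Suc K)
  have "int (Suc K) * int (n choose Suc K) = (int n - int K) * int (n choose K)"
  proof (cases "K \<le> n")
    case True
    have "Suc K * (n choose Suc K) = (n - K) * (n choose K)"
      using binomial_absorb_comp[of n K] binomial_absorption[of K "n"] by (cases n) auto
    then show ?thesis using True by (metis of_nat_diff of_nat_mult)
  qed (simp add: binomial_eq_0)
  moreover have "int (Suc K) * int ((Suc n + Suc K) choose Suc K) =
      int (Suc n + Suc K) * int ((Suc n + K) choose K)"
    using Suc_times_binomial[of K "Suc n + K"]
    by (metis add_Suc_right of_nat_mult)
  ultimately have "(int (Suc K) * int (n choose Suc K)) *
      (int (Suc K) * int ((Suc n + Suc K) choose Suc K)) =
      ((int n - int K) * int (Suc n + Suc K)) * (int (n choose K) * int ((Suc n + K) choose K))"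
    by (simp only: ac_simps)
  also have "(int n - int K) * int (Suc n + Suc K) = (int (Suc n))\<^sup>2 - (int (Suc K))\<^sup>2"
    by (simp add: power2_eq_square algebra_simps)
  finally have "(fact K)\<^sup>2 * ((int (Suc K))\<^sup>2 * int (n choose Suc K) *
      int ((Suc n + Suc K) choose Suc K)) =
      (fact K)\<^sup>2 * int (n choose K) * int ((Suc n + K) choose K) *
      ((int (Suc n))\<^sup>2 - (int (Suc K))\<^sup>2)"
    by (simp only: power2_eq_square ac_simps)
  then show ?case
    unfolding Suc.IH by (simp add: power_mult_distrib ac_simps)
qed

text \<open>
  If \<open>p\<close> divides \<open>n + 1\<close>, then the factors \<open>(n + 1)\<^sup>2 - i\<^sup>2\<close> of the preceding product are \<open>- i\<^sup>2\<close>
  modulo \<open>p\<^sup>2\<close>. There are evenly many of them, so their product is \<open>(fact (p - 1))\<^sup>2\<close>, which cancels.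
\<close>
lemma binomial_product_cong:
  assumes "prime p" and "odd p"
  shows "[int (n choose (p - 1)) * int ((Suc n + (p - 1)) choose (p - 1)) =
     (if p dvd Suc n then 1 else 0)] (mod (int p)\<^sup>2)"
proof (cases "p dvd Suc n")
  case False
  have p: "0 < p" using assms(1) by (rule prime_gt_0_nat)
  have "\<not> p dvd Suc (Suc n + (p - 1))"
    using False p dvd_add_left_iff[of p p "Suc n"] by simp
  then have "p * p dvd (n choose (p - 1)) * ((Suc n + (p - 1)) choose (p - 1))"
    using False assms(1) by (intro mult_dvd_mono prime_dvd_binomial_pred)
  then have "int (p * p) dvd int ((n choose (p - 1)) * ((Suc n + (p - 1)) choose (p - 1)))"
    by (simp only: of_nat_dvd_iff)
  then show ?thesis
    using False by (simp add: cong_0_iff power2_eq_square)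
next
  case True
  let ?B = "int (n choose (p - 1)) * int ((Suc n + (p - 1)) choose (p - 1))"
  have "(int p)\<^sup>2 dvd (int (Suc n))\<^sup>2" using True by (intro dvd_power_same) (simp only: of_nat_dvd_iff)
  then have "[(int (Suc n))\<^sup>2 = 0] (mod (int p)\<^sup>2)" by (simp only: cong_0_iff)
  then have step: "[(int (Suc n))\<^sup>2 - (int i)\<^sup>2 = 0 - (int i)\<^sup>2] (mod (int p)\<^sup>2)" for i
    by (intro cong_diff cong_refl)
  have "[(fact (p - 1))\<^sup>2 * ?B = (\<Prod>i=1..p - 1. 0 - (int i)\<^sup>2)] (mod (int p)\<^sup>2)"
    unfolding mult.assoc[symmetric] fact_square_binomial_product by (intro cong_prod step)
  also have "(\<Prod>i=1..p - 1. 0 - (int i)\<^sup>2) = (\<Prod>i=1..p - 1. (- 1) * (int i)\<^sup>2)" by simp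
  also have "\<dots> = (fact (p - 1))\<^sup>2 * 1"
    using assms(2) unfolding prod.distrib fact_prod
    by (simp add: prod_power_distrib)
  finally have "[(fact (p - 1))\<^sup>2 * ?B = (fact (p - 1))\<^sup>2 * 1] (mod (int p)\<^sup>2)" .
  moreover have "coprime ((fact (p - 1))\<^sup>2) ((int p)\<^sup>2)"
  proof -
    have "\<not> p dvd fact (p - 1)"
      using assms(1) prime_dvd_fact_iff[of p "p - 1"] prime_gt_0_nat[OF assms(1)] by simp
    then have "coprime p (fact (p - 1))" using assms(1) by (simp add: prime_imp_coprime)
    then have "coprime (int p) (int (fact (p - 1)))" by (simp only: coprime_int_iff)
    then show ?thesis by (simp add: coprime_commute)
  qed
  ultimately have "[?B = 1] (mod (int p)\<^sup>2)" by (metis cong_mult_lcancel)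
  then show ?thesis using True by simp
qed

text \<open>
  At a multiple of \<open>p\<close>, reached from \<open>n\<close> with \<open>n mod p = p - 1\<close>, the evenness of \<open>p - 1\<close> makes
  the value at \<open>n\<close> equal to \<open>1\<close>, and the recurrence gives \<open>2 - 1 = 1\<close>.
\<close>
lemma alt_binomial_sum_cong:
  assumes "prime p" and "odd p"
  shows "[alt_binomial_sum (p - 1) n = (- 1) ^ (n mod p)] (mod (int p)\<^sup>2)"
proof (induction n)
  case 0
  have "alt_binomial_sum (p - 1) 0 = (\<Sum>k\<le>p - 1. if k = 0 then 1 else 0)"
    unfolding alt_binomial_sum_def by (intro sum.cong refl) (simp add: binomial_eq_0)
  then show ?case by simp
next
  case (Suc n)
  let ?e = "if p dvd Suc n then 1 else 0 :: int"
  have "alt_binomial_sum (p - 1) (Suc n) =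
      2 * (int (n choose (p - 1)) * int ((Suc n + (p - 1)) choose (p - 1)))
      - alt_binomial_sum (p - 1) n"
    using alt_binomial_sum_Suc[of "p - 1" n] assms(2) by (simp add: algebra_simps)
  also have "[\<dots> = 2 * ?e - (- 1) ^ (n mod p)] (mod (int p)\<^sup>2)"
    using binomial_product_cong[OF assms] Suc.IH by (intro cong_diff cong_scalar_left)
  also have "2 * ?e - (- 1) ^ (n mod p) = (- 1) ^ (Suc n mod p)"
  proof (cases "p dvd Suc n")
    case True
    then have "Suc (n mod p) = p" by (metis mod_Suc mod_eq_0_iff_dvd nat.distinct(1))
    then have "even (n mod p)" using assms(2) by (metis even_Suc)
    then show ?thesis using True by (simp add: mod_eq_0_iff_dvd)
  next
    case False
    then have "Suc n mod p = Suc (n mod p)" by (metis mod_Suc mod_0_imp_dvd)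
    then show ?thesis using False by simp
  qed
  finally show ?case .
qed

section \<open>Congruences in the ring of p-integers\<close>

text \<open>
  The fraction need not be in lowest terms: its reduced denominator divides \<open>v\<close>.
\<close>
lemma p_integersI:
  assumes "x = of_int u / of_int v" and "\<not> int p dvd v"
  shows "x \<in> p_integers p"
proof -
  obtain u' v' where q: "quotient_of x = (u', v')" by force
  have v': "v' > 0" and cop: "coprime u' v'" and x: "x = of_int u' / of_int v'"
    using q quotient_of_denom_pos quotient_of_coprime quotient_of_div by auto
  have "v \<noteq> 0" using assms(2) by auto
  then have "(of_int (u * v') :: rat) = of_int (u' * v)"
    using x v' assms(1) by (simp add: field_simps)
  then have "u * v' = u' * v" by (simp only: of_int_eq_iff)
  then have "v' dvd u' * v" by (metis dvd_triv_right)
  then have "v' dvd v" using cop by (simp add: coprime_commute coprime_dvd_mult_right_iff)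
  then show ?thesis using q assms(2) by (auto simp: p_integers_def intro: dvd_trans)
qed

lemma p_integersE:
  assumes "x \<in> p_integers p"
  obtains u v where "x = of_int u / of_int v" and "\<not> int p dvd v" and "v \<noteq> 0"
proof -
  obtain u v where "quotient_of x = (u, v)" by force
  with assms that[of u v] show ?thesis
    by (metis p_integers_def mem_Collect_eq snd_conv quotient_of_div dvd_0_right)
qed

context
  fixes p :: nat
  assumes prime: "prime p"
begin

lemma p_integers_of_int: "of_int i \<in> p_integers p"
  using prime not_prime_1 by (intro p_integersI[of _ i 1]) auto

lemma p_integers_of_nat: "of_nat n \<in> p_integers p"
  using p_integers_of_int[of "int n"] by simp

lemma p_integers_mult:
  assumes "x \<in> p_integers p" and "y \<in> p_integers p"
  shows "x * y \<in> p_integers p"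
proof -
  obtain u v where x: "x = of_int u / of_int v" "\<not> int p dvd v"
    using assms(1) by (rule p_integersE)
  obtain u' v' where y: "y = of_int u' / of_int v'" "\<not> int p dvd v'"
    using assms(2) by (rule p_integersE)
  have "\<not> int p dvd v * v'" using x(2) y(2) prime by (simp add: prime_dvd_mult_iff)
  then show ?thesis using x(1) y(1) by (intro p_integersI[of _ "u * u'" "v * v'"]) auto
qed

lemma p_integers_add:
  assumes "x \<in> p_integers p" and "y \<in> p_integers p"
  shows "x + y \<in> p_integers p"
proof -
  obtain u v where x: "x = of_int u / of_int v" "\<not> int p dvd v" "v \<noteq> 0"
    using assms(1) by (rule p_integersE)
  obtain u' v' where y: "y = of_int u' / of_int v'" "\<not> int p dvd v'" "v' \<noteq> 0"
    using assms(2) by (rule p_integersE)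
  have "\<not> int p dvd v * v'" using x(2) y(2) prime by (simp add: prime_dvd_mult_iff)
  then show ?thesis using x y
    by (intro p_integersI[of _ "u * v' + u' * v" "v * v'"]) (auto simp: field_simps)
qed

lemma p_integers_inverse_of_nat:
  assumes "\<not> p dvd n"
  shows "1 / of_nat n \<in> p_integers p"
  using assms by (intro p_integersI[of _ 1 "int n"]) auto

lemma p_cong_refl: "x \<in> p_integers p \<Longrightarrow> p_cong p m x x"
  using p_integers_of_int[of 0] unfolding p_cong_def by (auto intro!: bexI[of _ 0])

lemma p_cong_trans:
  assumes "p_cong p m x y" and "p_cong p m y z"
  shows "p_cong p m x z"
proof -
  obtain s t where "s \<in> p_integers p" "x - y = of_nat m * s" "t \<in> p_integers p" "y - z = of_nat m * t"
    using assms unfolding p_cong_def by blast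
  then have "x - z = of_nat m * (s + t)" and "s + t \<in> p_integers p"
    by (simp_all add: p_integers_add algebra_simps)
  then show ?thesis using assms unfolding p_cong_def by blast
qed

lemma p_cong_add:
  assumes "p_cong p m x x'" and "p_cong p m y y'"
  shows "p_cong p m (x + y) (x' + y')"
proof -
  obtain s t where "s \<in> p_integers p" "x - x' = of_nat m * s" "t \<in> p_integers p" "y - y' = of_nat m * t"
    using assms unfolding p_cong_def by blast
  then have "(x + y) - (x' + y') = of_nat m * (s + t)" and "s + t \<in> p_integers p"
    by (simp_all add: p_integers_add algebra_simps)
  then show ?thesis using assms p_integers_add unfolding p_cong_def by blast
qed

lemma p_cong_mult:
  assumes "p_cong p m x x'" and "p_cong p m y y'"
  shows "p_cong p m (x * y) (x' * y')"
proof -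
  obtain s t where st: "s \<in> p_integers p" "x - x' = of_nat m * s" "t \<in> p_integers p" "y - y' = of_nat m * t"
    using assms unfolding p_cong_def by blast
  have "x * y - x' * y' = (x - x') * y + x' * (y - y')" by (simp add: algebra_simps)
  also have "\<dots> = of_nat m * (s * y + x' * t)" by (simp add: st algebra_simps)
  finally have "x * y - x' * y' = of_nat m * (s * y + x' * t)" .
  moreover have "s * y + x' * t \<in> p_integers p"
    using st assms unfolding p_cong_def by (intro p_integers_add p_integers_mult) auto
  ultimately show ?thesis using assms p_integers_mult unfolding p_cong_def by blast
qed

lemma p_cong_sum:
  assumes "\<And>i. i \<in> I \<Longrightarrow> p_cong p m (f i) (g i)"
  shows "p_cong p m (\<Sum>i\<in>I. f i) (\<Sum>i\<in>I. g i)"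
  using assms
proof (induction I rule: infinite_finite_induct)
  case (insert i I)
  then show ?case by (simp add: p_cong_add)
qed (use p_cong_refl[OF p_integers_of_int[of 0]] in auto)

lemma p_cong_of_int:
  assumes "[i = j] (mod int m)"
  shows "p_cong p m (of_int i) (of_int j)"
proof -
  obtain t where "i - j = int m * t" using assms unfolding cong_iff_dvd_diff by (elim dvdE)
  then have "(of_int (i - j) :: rat) = of_int (int m * t)" by simp
  then have "of_int i - of_int j = (of_nat m :: rat) * of_int t" by simp
  then show ?thesis unfolding p_cong_def using p_integers_of_int by blast
qed

text \<open>
  Each of the factors \<open>1 / (i + 1)\<close> by which \<open>x gchoose k\<close> is built up is a \<open>p\<close>-integer, as
  \<open>i + 1 \<le> k < p\<close>.
\<close>
lemma p_cong_gbinomial: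
  assumes "p_cong p m x y" and "k < p"
  shows "p_cong p m (x gchoose k) (y gchoose k)"
  using assms(2)
proof (induction k)
  case 0
  show ?case using p_cong_refl[OF p_integers_of_int[of 1]] by simp
next
  case (Suc k)
  have rec: "(z gchoose Suc k) = (z gchoose k) * (z + of_int (- int k)) * (1 / of_nat (Suc k))"
    for z :: rat
    using gbinomial_absorb_comp[of z k] gbinomial_absorption[of k z] by (simp add: field_simps)
  have "\<not> p dvd Suc k" using Suc.prems by (auto dest: dvd_imp_le)
  then show ?case
    unfolding rec using Suc.IH Suc.prems assms(1)
    by (intro p_cong_mult p_cong_add p_cong_refl p_integers_inverse_of_nat p_integers_of_int) auto
qed

text \<open>
  The natural number is found from its two lowest digits in base \<open>p\<close>: the first is the residue of
  \<open>a\<close>, the second that of \<open>(a - r) / p\<close>.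
\<close>
lemma ex_nat_p_cong_square:
  assumes "a \<in> p_integers p"
  shows "\<exists>n. n mod p = least_residue p a \<and> p_cong p (p\<^sup>2) a (of_nat n)"
proof -
  let ?r = "least_residue p a"
  obtain z where z: "z \<in> p_integers p" "a - of_nat ?r = of_nat p * z"
    using least_residue_cong[OF prime assms] unfolding p_cong_def by blast
  obtain s where "p_cong p p z (of_nat s)" using ex_residue[OF prime z(1)] by blast
  then obtain t where t: "t \<in> p_integers p" "z - of_nat s = of_nat p * t"
    unfolding p_cong_def by blast
  have "a - of_nat (?r + p * s) = of_nat p * (z - of_nat s)"
    using z(2) by (simp add: algebra_simps)
  also have "\<dots> = of_nat (p\<^sup>2) * t" unfolding t(2) by (simp add: power2_eq_square)
  finally have "p_cong p (p\<^sup>2) a (of_nat (?r + p * s))"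
    using assms t(1) p_integers_of_nat unfolding p_cong_def by blast
  moreover have "(?r + p * s) mod p = ?r" using least_residue_less[OF prime assms] by simp
  ultimately show ?thesis by blast
qed

end

section \<open>The congruence for p-integral arguments\<close>

lemma alt_binomial_sum_eq_gbinomial:
  "of_int (alt_binomial_sum N n) =
     (\<Sum>k=0..N. (of_nat n gchoose k) * ((- 1 - of_nat n) gchoose k :: rat))"
proof -
  have "((- 1 - of_nat n) gchoose k :: rat) = (- 1) ^ k * of_nat ((n + k) choose k)" for k
    using gbinomial_minus[of "of_nat (Suc n) :: rat" k]
    by (simp add: binomial_gbinomial algebra_simps)
  then show ?thesis
    by (simp add: alt_binomial_sum_def atLeast0AtMost binomial_gbinomial ac_simps)
qed

theorem corollary2p2:
  fixes p :: nat and a :: rat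
  assumes "prime p" and "odd p" and "a \<in> p_integers p"
  shows "gen_legendre (p - 1) a (- 1) = (\<Sum>k=0..p-1. (a gchoose k) * ((- 1 - a) gchoose k))
    \<and> p_cong p (p^2) (\<Sum>k=0..p-1. (a gchoose k) * ((- 1 - a) gchoose k)) ((- 1) ^ least_residue p a)"
proof
  show "gen_legendre (p - 1) a (- 1) = (\<Sum>k=0..p-1. (a gchoose k) * ((- 1 - a) gchoose k))"
    by (simp add: gen_legendre_def)
next
  obtain n where n: "n mod p = least_residue p a" and an: "p_cong p (p\<^sup>2) a (of_nat n)"
    using ex_nat_p_cong_square[OF assms(1,3)] by blast
  have one: "p_cong p (p\<^sup>2) (of_int (- 1)) (of_int (- 1))"
    by (intro p_cong_refl p_integers_of_int assms(1))
  have an': "p_cong p (p\<^sup>2) (- 1 - a) (- 1 - of_nat n)"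
    using p_cong_add[OF assms(1) one p_cong_mult[OF assms(1) one an]] by simp
  have "k < p" if "k \<in> {0..p - 1}" for k using that prime_gt_0_nat[OF assms(1)] by auto
  then have "p_cong p (p\<^sup>2) (\<Sum>k=0..p-1. (a gchoose k) * ((- 1 - a) gchoose k))
      (of_int (alt_binomial_sum (p - 1) n))"
    unfolding alt_binomial_sum_eq_gbinomial
    by (intro p_cong_sum p_cong_mult p_cong_gbinomial an an' assms(1))
  moreover have "p_cong p (p\<^sup>2) (of_int (alt_binomial_sum (p - 1) n)) (of_int ((- 1) ^ (n mod p)))"
    using alt_binomial_sum_cong[OF assms(1,2)] by (intro p_cong_of_int assms(1)) simp
  ultimately show "p_cong p (p^2) (\<Sum>k=0..p-1. (a gchoose k) * ((- 1 - a) gchoose k))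
      ((- 1) ^ least_residue p a)"
    unfolding n by (metis (no_types) p_cong_trans assms(1) of_int_power of_int_minus of_int_1)
qed

end
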